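(* Let $u:\overline{\mathbb{U}}\to\mathbb{R}^m$ be continuous on $\overline{\mathbb{U}}$ and harmonic on the unit disk $\mathbb{U}$, and suppose that the curve $\gamma(t)=u(e^{it})$, $t\in[0,2\pi]$, is rectifiable, with length $L$. Then: d1) there is a holomorphic map $F:\mathbb{U}\to\mathbb{C}^m$ such that $u=\operatorname{Re}F$ on $\mathbb{U}$, and for such $F$ one has $\pi|F'(0)|\le L$; d2) $2\pi|D_zu(0)|\le L$; d3) if in addition $u$ is conformal at $0$, then $2\pi\Lambda_u(0)\le L$.
   Context: $\mathbb{U}$ is the open unit disk in $\mathbb{C}$. Harmonicity and real parts are componentwise; $|\cdot|$ is the Euclidean (Hermitian) norm on $\mathbb{R}^m$ and $\mathbb{C}^m$. $D_zu=\frac12(u'_x-iu'_y)\in\mathbb{C}^m$. $u$ is conformal at $0$ if $|u'_x(0)|=|u'_y(0)|$ and $u'_x(0)\cdot u'_y(0)=0$. $\Lambda_u(0)$ is the operator norm of the differential of $u$ at $0$. *)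

theory Defs
  imports "HOL-Analysis.Analysis"
begin

definition partial_x :: "(complex \<Rightarrow> 'a::real_normed_vector) \<Rightarrow> complex \<Rightarrow> 'a"
  where "partial_x f z = vector_derivative (\<lambda>t. f (z + of_real t)) (at 0)"

definition partial_y :: "(complex \<Rightarrow> 'a::real_normed_vector) \<Rightarrow> complex \<Rightarrow> 'a"
  where "partial_y f z = vector_derivative (\<lambda>t. f (z + \<i> * of_real t)) (at 0)"

text \<open>The predicates below are meant for open sets \<open>S\<close>. Differentiability is in the
  real (Frechet) sense.\<close>

definition continuously_differentiable_on ::
    "(complex \<Rightarrow> 'a::real_normed_vector) \<Rightarrow> complex set \<Rightarrow> bool"
  where "continuously_differentiable_on f S \<longleftrightarrow>
    f differentiable_on S \<and> continuous_on S (partial_x f) \<and> continuous_on S (partial_y f)"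

definition harmonic_on :: "(complex \<Rightarrow> real) \<Rightarrow> complex set \<Rightarrow> bool"
  where "harmonic_on f S \<longleftrightarrow>
    continuously_differentiable_on f S \<and>
    continuously_differentiable_on (partial_x f) S \<and>
    continuously_differentiable_on (partial_y f) S \<and>
    (\<forall>z\<in>S. partial_x (partial_x f) z + partial_y (partial_y f) z = 0)"

definition harmonic_map_on :: "(complex \<Rightarrow> real ^ 'm) \<Rightarrow> complex set \<Rightarrow> bool"
  where "harmonic_map_on u S \<longleftrightarrow> (\<forall>i. harmonic_on (\<lambda>z. u z $ i) S)"

definition holomorphic_map_on :: "(complex \<Rightarrow> complex ^ 'm) \<Rightarrow> complex set \<Rightarrow> bool"
  where "holomorphic_map_on F S \<longleftrightarrow> (\<forall>i. (\<lambda>z. F z $ i) holomorphic_on S)"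

definition deriv_map :: "(complex \<Rightarrow> complex ^ 'm) \<Rightarrow> complex \<Rightarrow> complex ^ 'm"
  where "deriv_map F z = (\<chi> i. deriv (\<lambda>w. F w $ i) z)"

definition Re_vec :: "complex ^ 'm \<Rightarrow> real ^ 'm"
  where "Re_vec v = (\<chi> i. Re (v $ i))"

definition wirtinger_z :: "(complex \<Rightarrow> real ^ 'm) \<Rightarrow> complex \<Rightarrow> complex ^ 'm"
  where "wirtinger_z u z =
    (\<chi> i. (complex_of_real (partial_x u z $ i) - \<i> * complex_of_real (partial_y u z $ i)) / 2)"

definition conformal_at :: "(complex \<Rightarrow> real ^ 'm) \<Rightarrow> complex \<Rightarrow> bool"
  where "conformal_at u z \<longleftrightarrow>
    norm (partial_x u z) = norm (partial_y u z) \<and> partial_x u z \<bullet> partial_y u z = 0"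

definition differential_norm :: "(complex \<Rightarrow> real ^ 'm) \<Rightarrow> complex \<Rightarrow> real"
  where "differential_norm u z = onorm (frechet_derivative u (at z))"

definition polygon_lengths :: "(real \<Rightarrow> 'a::metric_space) \<Rightarrow> real \<Rightarrow> real \<Rightarrow> real set"
  where "polygon_lengths g a b =
    {(\<Sum>k<n. dist (g (t k)) (g (t (Suc k)))) | (n::nat) t.
       t 0 = a \<and> t n = b \<and> (\<forall>k<n. t k < t (Suc k))}"

definition rectifiable_on :: "(real \<Rightarrow> 'a::metric_space) \<Rightarrow> real \<Rightarrow> real \<Rightarrow> bool"
  where "rectifiable_on g a b \<longleftrightarrow> bdd_above (polygon_lengths g a b)"

text \<open>Only meaningful for \<open>a \<le> b\<close> and curves that are rectifiable: the supremum is a real number.\<close>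

definition curve_length :: "(real \<Rightarrow> 'a::metric_space) \<Rightarrow> real \<Rightarrow> real \<Rightarrow> real"
  where "curve_length g a b = Sup (polygon_lengths g a b)"

end

theory Submission
  imports Defs "HOL-Complex_Analysis.Complex_Analysis"
begin

text \<open>Write \<open>u = Re F\<close>, \<open>c = F'(0)\<close>, and let \<open>A h = Re (h c)\<close> be the differential of \<open>u\<close>
  at \<open>0\<close>. All the length estimates come from one inequality,
  \<open>\<pi> |c|\<^sup>2 \<le> \<parallel>A\<parallel> L\<close>, proved in \<open>energy_le_onorm_times_length\<close>. Here
  \<open>|c|\<^sup>2 = |A 1|\<^sup>2 + |A \<i>|\<^sup>2\<close> is the squared Hilbert-Schmidt norm of \<open>A\<close>, while \<open>\<parallel>A\<parallel>\<close> is its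
  operator norm.

  The first Fourier coefficient of the boundary values of \<open>u\<close> is \<open>c\<close>, up to a constant factor
  (\<open>first_Fourier_coefficient_of_boundary_values\<close>). Pairing it with \<open>c\<close> itself gives
  \<open>\<pi> |c|\<^sup>2 = \<integral> u (cis t) \<bullet> A (cis t) dt\<close> over \<open>[0, 2 \<pi>]\<close>. The factor \<open>A (cis t)\<close> is the
  derivative of the closed curve \<open>A (- \<i> cis t)\<close>, which stays in the ball of radius \<open>\<parallel>A\<parallel>\<close>.
  Integration by parts moves the derivative onto the boundary curve of \<open>u\<close>, so that the integral is
  at most \<open>\<parallel>A\<parallel> L\<close>. As that curve is merely rectifiable, this is done on Riemann sums
  (\<open>integral_inner_derivative_le_length\<close>).

  In general \<open>\<parallel>A\<parallel> \<le> |c|\<close>, whence \<open>\<pi> |c| \<le> L\<close>; the Wirtinger derivative of \<open>u\<close> at \<open>0\<close> is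
  \<open>c / 2\<close>, so its bound is the same one. If \<open>u\<close> is conformal at \<open>0\<close>, then \<open>A\<close> is a multiple of
  an isometry, \<open>|c|\<^sup>2 = 2 \<parallel>A\<parallel>\<^sup>2\<close>, and the same inequality reads \<open>2 \<pi> \<parallel>A\<parallel>\<^sup>2 \<le> \<parallel>A\<parallel> L\<close>.

  The map \<open>F\<close> exists componentwise: \<open>u\<^sub>x - \<i> u\<^sub>y\<close> is holomorphic by Laplace's equation and the
  symmetry of second derivatives, and a primitive of it on the disk has real part \<open>u\<close> up to a
  constant.\<close>

section \<open>Symmetry of second derivatives\<close>

text \<open>Two applications of the mean value theorem: one in direction \<open>d\<close> to the difference of \<open>v\<close>
  along two opposite edges of the parallelogram, one in direction \<open>e\<close> to \<open>P\<close>. The left-hand side is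
  symmetric in \<open>d\<close> and \<open>e\<close>, and this is why mixed derivatives commute.\<close>

lemma second_difference_mean_value:
  fixes v :: "'a::real_normed_vector \<Rightarrow> real"
  assumes P: "\<And>w. w \<in> S \<Longrightarrow> ((\<lambda>t. v (w + t *\<^sub>R d)) has_real_derivative P w) (at 0)"
    and Q: "\<And>w. w \<in> S \<Longrightarrow> ((\<lambda>t. P (w + t *\<^sub>R e)) has_real_derivative Q w) (at 0)"
    and h: "0 < h"
    and sub: "\<And>s t. s \<in> {0..h} \<Longrightarrow> t \<in> {0..h} \<Longrightarrow> z + s *\<^sub>R d + t *\<^sub>R e \<in> S"
  shows "\<exists>s\<in>{0..h}. \<exists>t\<in>{0..h}.
    v (z + h *\<^sub>R d + h *\<^sub>R e) - v (z + h *\<^sub>R d) - v (z + h *\<^sub>R e) + v z = h\<^sup>2 * Q (z + s *\<^sub>R d + t *\<^sub>R e)"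
proof -
  have shift: "((\<lambda>t. f (w + t *\<^sub>R k)) has_real_derivative D) (at s)"
    if "((\<lambda>t. f ((w + s *\<^sub>R k) + t *\<^sub>R k)) has_real_derivative D) (at 0)"
    for f :: "'a \<Rightarrow> real" and w k D s
    using that DERIV_shift[of "\<lambda>t. f (w + t *\<^sub>R k)" D 0 s]
    by (simp add: algebra_simps)
  define \<phi> where "\<phi> s = v ((z + h *\<^sub>R e) + s *\<^sub>R d) - v (z + s *\<^sub>R d)" for s
  have "(\<phi> has_real_derivative P ((z + h *\<^sub>R e) + s *\<^sub>R d) - P (z + s *\<^sub>R d)) (at s)"
    if "0 \<le> s" "s \<le> h" for s
    unfolding \<phi>_def
    using sub[of s h] sub[of s 0] that h
    by (intro DERIV_diff) (rule shift, rule P, simp add: add_ac)+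
  from MVT2[OF h this] obtain s where s: "0 < s" "s < h"
    and 1: "\<phi> h - \<phi> 0 = h * (P ((z + h *\<^sub>R e) + s *\<^sub>R d) - P (z + s *\<^sub>R d))" by auto
  have "((\<lambda>t. P ((z + s *\<^sub>R d) + t *\<^sub>R e)) has_real_derivative Q ((z + s *\<^sub>R d) + t *\<^sub>R e)) (at t)"
    if "0 \<le> t" "t \<le> h" for t
    using sub[of s t] that s by - (rule shift, rule Q, simp)
  from MVT2[OF h this] obtain t where t: "0 < t" "t < h"
    and 2: "P ((z + s *\<^sub>R d) + h *\<^sub>R e) - P (z + s *\<^sub>R d) = h * Q ((z + s *\<^sub>R d) + t *\<^sub>R e)" by auto
  have "v (z + h *\<^sub>R d + h *\<^sub>R e) - v (z + h *\<^sub>R d) - v (z + h *\<^sub>R e) + v z = h\<^sup>2 * Q (z + s *\<^sub>R d + t *\<^sub>R e)"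
    using 1 2 unfolding \<phi>_def by (simp add: add_ac power2_eq_square)
  with s t show ?thesis by (intro bexI[of _ s] bexI[of _ t]) auto
qed

text \<open>Both mixed derivatives take in each small parallelogram at \<open>z\<close>, though at different points, the same value,
  namely the second difference divided by \<open>h\<^sup>2\<close>; continuity does the rest.\<close>

lemma mixed_derivatives_commute:
  fixes v :: "'a::real_normed_vector \<Rightarrow> real"
  assumes S: "open S" "z \<in> S"
    and P: "\<And>w. w \<in> S \<Longrightarrow> ((\<lambda>t. v (w + t *\<^sub>R d)) has_real_derivative P w) (at 0)"
    and Q: "\<And>w. w \<in> S \<Longrightarrow> ((\<lambda>t. P (w + t *\<^sub>R e)) has_real_derivative Q w) (at 0)"
    and P': "\<And>w. w \<in> S \<Longrightarrow> ((\<lambda>t. v (w + t *\<^sub>R e)) has_real_derivative P' w) (at 0)"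
    and Q': "\<And>w. w \<in> S \<Longrightarrow> ((\<lambda>t. P' (w + t *\<^sub>R d)) has_real_derivative Q' w) (at 0)"
    and cont: "continuous_on S Q" "continuous_on S Q'"
  shows "Q z = Q' z"
proof -
  have "\<bar>Q z - Q' z\<bar> \<le> 0 + \<epsilon>" if "\<epsilon> > 0" for \<epsilon>
  proof -
    have lim: "(Q \<longlongrightarrow> Q z) (nhds z)" "(Q' \<longlongrightarrow> Q' z) (nhds z)"
      using cont S
      by (simp_all add: continuous_on_eq_continuous_at continuous_at tendsto_at_iff_tendsto_nhds)
    then have "eventually (\<lambda>w. \<bar>Q w - Q z\<bar> < \<epsilon>/2 \<and> \<bar>Q' w - Q' z\<bar> < \<epsilon>/2 \<and> w \<in> S) (nhds z)"
      using that S tendstoD[OF lim(1), of "\<epsilon>/2"] tendstoD[OF lim(2), of "\<epsilon>/2"]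
      by (intro eventually_conj eventually_nhds_in_open) (simp_all add: dist_real_def)
    then obtain \<delta> where \<delta>: "\<delta> > 0"
      and near: "\<And>w. dist w z < \<delta> \<Longrightarrow> \<bar>Q w - Q z\<bar> < \<epsilon>/2 \<and> \<bar>Q' w - Q' z\<bar> < \<epsilon>/2 \<and> w \<in> S"
      by (auto simp: eventually_nhds_metric)
    \<comment> \<open>The summand \<open>1\<close> keeps the denominator positive when \<open>d\<close> and \<open>e\<close> vanish, and makes the
      parallelogram of side lengths \<open>h |d|\<close>, \<open>h |e|\<close> lie strictly inside the \<open>\<delta>\<close>-ball.\<close>
    define h where "h = \<delta> / (norm d + norm e + 1)"
    have pos: "0 < norm d + norm e + 1" by (smt (verit) norm_ge_zero)
    have h: "h > 0" using \<delta> pos by (simp add: h_def)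
    have close: "dist (z + s *\<^sub>R d + t *\<^sub>R e) z < \<delta>" if "s \<in> {0..h}" "t \<in> {0..h}" for s t
    proof -
      have "dist (z + s *\<^sub>R d + t *\<^sub>R e) z \<le> s * norm d + t * norm e"
        using that norm_triangle_ineq[of "s *\<^sub>R d" "t *\<^sub>R e"] by (simp add: dist_norm add.assoc)
      also have "\<dots> \<le> h * norm d + h * norm e"
        using that by (intro add_mono mult_right_mono) auto
      also have "\<dots> < h * (norm d + norm e + 1)" using h by (simp add: algebra_simps)
      also have "\<dots> = \<delta>" using pos by (simp add: h_def)
      finally show ?thesis .
    qed
    have close': "dist (z + s *\<^sub>R e + t *\<^sub>R d) z < \<delta>" if "s \<in> {0..h}" "t \<in> {0..h}" for s t
      using close[OF that(2,1)] by (simp add: add_ac)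
    obtain s t where st: "s \<in> {0..h}" "t \<in> {0..h}"
      and 1: "v (z + h *\<^sub>R d + h *\<^sub>R e) - v (z + h *\<^sub>R d) - v (z + h *\<^sub>R e) + v z = h\<^sup>2 * Q (z + s *\<^sub>R d + t *\<^sub>R e)"
      using second_difference_mean_value[OF P Q h near[OF close, THEN conjunct2, THEN conjunct2]] by blast
    obtain s' t' where st': "s' \<in> {0..h}" "t' \<in> {0..h}"
      and 2: "v (z + h *\<^sub>R e + h *\<^sub>R d) - v (z + h *\<^sub>R e) - v (z + h *\<^sub>R d) + v z = h\<^sup>2 * Q' (z + s' *\<^sub>R e + t' *\<^sub>R d)"
      using second_difference_mean_value[OF P' Q' h near[OF close', THEN conjunct2, THEN conjunct2]] by blast
    have "h\<^sup>2 * Q (z + s *\<^sub>R d + t *\<^sub>R e) = h\<^sup>2 * Q' (z + s' *\<^sub>R e + t' *\<^sub>R d)"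
      using 1 2 by (simp add: algebra_simps)
    then have "Q (z + s *\<^sub>R d + t *\<^sub>R e) = Q' (z + s' *\<^sub>R e + t' *\<^sub>R d)"
      using h by simp
    then show ?thesis
      using near[OF close[OF st]] near[OF close'[OF st']] by linarith
  qed
  then have "\<bar>Q z - Q' z\<bar> \<le> 0" by (rule field_le_epsilon)
  then show ?thesis by simp
qed

section \<open>Harmonic functions as real parts of holomorphic functions\<close>

lemma has_derivative_along_line:
  assumes "(f has_derivative D) (at z)"
  shows "((\<lambda>t. f (z + t *\<^sub>R d)) has_vector_derivative D d) (at 0)"
proof -
  have "((\<lambda>t. z + t *\<^sub>R d) has_derivative (\<lambda>t. t *\<^sub>R d)) (at 0)"
    by (auto intro!: derivative_eq_intros)
  from has_derivative_compose[OF this] assms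
  have "((\<lambda>t. f (z + t *\<^sub>R d)) has_derivative (\<lambda>t. D (t *\<^sub>R d))) (at 0)" by auto
  then show ?thesis
    using assms by (simp add: has_vector_derivative_def linear_cmul has_derivative_linear)
qed

lemma partials_of_derivative:
  assumes "(f has_derivative D) (at z)"
  shows "partial_x f z = D 1" "partial_y f z = D \<i>"
proof -
  have "((\<lambda>t. f (z + of_real t)) has_vector_derivative D 1) (at 0)"
    using has_derivative_along_line[OF assms, of 1] by (simp only: scaleR_conv_of_real mult_1_right)
  then show "partial_x f z = D 1" unfolding partial_x_def by (rule vector_derivative_at)
  have "((\<lambda>t. f (z + \<i> * of_real t)) has_vector_derivative D \<i>) (at 0)"
    using has_derivative_along_line[OF assms, of \<i>] by (simp only: scaleR_conv_of_real mult.commute)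
  then show "partial_y f z = D \<i>" unfolding partial_y_def by (rule vector_derivative_at)
qed

lemma derivative_from_partials:
  assumes "f differentiable (at z)"
  shows "(f has_derivative (\<lambda>h. Re h *\<^sub>R partial_x f z + Im h *\<^sub>R partial_y f z)) (at z)"
proof -
  from assms obtain D where D: "(f has_derivative D) (at z)" by (auto simp: differentiable_def)
  interpret D: bounded_linear D using D by (rule has_derivative_bounded_linear)
  have "D h = Re h *\<^sub>R D 1 + Im h *\<^sub>R D \<i>" for h
  proof -
    have "D h = D (Re h *\<^sub>R 1 + Im h *\<^sub>R \<i>)"
      by (rule arg_cong[of _ _ D]) (simp add: complex_eq_iff)
    then show ?thesis by (simp add: D.add D.scaleR)
  qed
  then have "D = (\<lambda>h. Re h *\<^sub>R D 1 + Im h *\<^sub>R D \<i>)" by blast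
  with D show ?thesis by (simp add: partials_of_derivative[OF D])
qed

lemma has_derivative_of_continuously_differentiable:
  assumes "continuously_differentiable_on f S" "open S" "z \<in> S"
  shows "(f has_derivative (\<lambda>h. Re h *\<^sub>R partial_x f z + Im h *\<^sub>R partial_y f z)) (at z)"
  using assms unfolding continuously_differentiable_on_def
  by (intro derivative_from_partials) (simp add: differentiable_on_eq_differentiable_at)

lemma mixed_partials_commute:
  fixes v :: "complex \<Rightarrow> real"
  assumes S: "open S" "z \<in> S"
    and v: "continuously_differentiable_on v S"
    and px: "continuously_differentiable_on (partial_x v) S"
    and py: "continuously_differentiable_on (partial_y v) S"
  shows "partial_y (partial_x v) z = partial_x (partial_y v) z"
proof -
  have dx: "((\<lambda>t. f (w + t *\<^sub>R 1)) has_real_derivative partial_x f w) (at 0)"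
    and dy: "((\<lambda>t. f (w + t *\<^sub>R \<i>)) has_real_derivative partial_y f w) (at 0)"
    if "continuously_differentiable_on f S" "w \<in> S" for f :: "complex \<Rightarrow> real" and w
    using has_derivative_along_line[OF has_derivative_of_continuously_differentiable[OF that(1) S(1) that(2)], of 1]
      has_derivative_along_line[OF has_derivative_of_continuously_differentiable[OF that(1) S(1) that(2)], of \<i>]
    by (simp_all add: has_real_derivative_iff_has_vector_derivative)
  show ?thesis
    using px py
    by (intro mixed_derivatives_commute[OF S dx[OF v] dy[OF px] dy[OF v] dx[OF py]])
       (simp_all add: continuously_differentiable_on_def)
qed

text \<open>The Cauchy-Riemann equations of \<open>v\<^sub>x - \<i> v\<^sub>y\<close> are the symmetry of second derivatives and
  Laplace's equation. A primitive \<open>f\<close> of this function, which exists as \<open>S\<close> is convex, satisfies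
  \<open>d (Re f) = v\<^sub>x dx + v\<^sub>y dy = d v\<close>.\<close>

lemma harmonic_on_eq_Re_holomorphic:
  fixes v :: "complex \<Rightarrow> real"
  assumes v: "harmonic_on v S" and S: "open S" "convex S"
  shows "\<exists>f. f holomorphic_on S \<and> (\<forall>z\<in>S. v z = Re (f z))"
proof -
  let ?p = "partial_x v" and ?q = "partial_y v"
  have C1: "continuously_differentiable_on v S" "continuously_differentiable_on ?p S"
      "continuously_differentiable_on ?q S"
    and laplace: "\<And>z. z \<in> S \<Longrightarrow> partial_x ?p z + partial_y ?q z = 0"
    using v by (auto simp: harmonic_on_def)
  have diff: "(f has_derivative (\<lambda>h. Re h * partial_x f w + Im h * partial_y f w)) (at w)"
    if "continuously_differentiable_on f S" "w \<in> S" for f :: "complex \<Rightarrow> real" and w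
    using has_derivative_of_continuously_differentiable[OF that(1) S(1) that(2)] by simp
  define g where "g z = Complex (?p z) (- ?q z)" for z
  have g_alt: "g = (\<lambda>z. of_real (?p z) - \<i> * of_real (?q z))"
    by (auto simp: g_def fun_eq_iff complex_eq_iff)
  have "(g has_field_derivative Complex (partial_x ?p z) (- partial_y ?p z)) (at z)"
    if z: "z \<in> S" for z
  proof -
    have qx: "partial_x ?q z = partial_y ?p z"
      using mixed_partials_commute[OF S(1) z C1] by simp
    have qy: "partial_y ?q z = - partial_x ?p z"
      using laplace[OF z] by simp
    have "(g has_derivative (\<lambda>h. of_real (Re h * partial_x ?p z + Im h * partial_y ?p z)
            - \<i> * of_real (Re h * partial_x ?q z + Im h * partial_y ?q z))) (at z)"
      unfolding g_alt
      by (intro has_derivative_diff has_derivative_mult_right has_derivative_of_real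
          diff[OF C1(2) z] diff[OF C1(3) z])
    then show ?thesis
      unfolding has_field_derivative_def
      by (rule has_derivative_eq_rhs) (auto simp: fun_eq_iff complex_eq_iff qx qy)
  qed
  then have "g holomorphic_on S"
    by (auto simp: holomorphic_on_open[OF S(1)])
  from holomorphic_convex_primitive'[OF S(2,1) this]
  obtain f where f: "\<And>z. z \<in> S \<Longrightarrow> (f has_field_derivative g z) (at z within S)" by blast
  have "((\<lambda>z. v z - Re (f z)) has_derivative (\<lambda>h. 0)) (at z within S)" if z: "z \<in> S" for z
  proof -
    have "((\<lambda>z. v z - Re (f z)) has_derivative
        (\<lambda>h. (Re h * ?p z + Im h * ?q z) - Re (g z * h))) (at z within S)"
      using f[OF z] unfolding has_field_derivative_def
      by (intro has_derivative_diff has_derivative_at_withinI[OF diff[OF C1(1) z]] has_derivative_Re)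
    then show ?thesis
      by (rule has_derivative_eq_rhs) (auto simp: fun_eq_iff g_def algebra_simps)
  qed
  from has_derivative_zero_constant[OF S(2) this]
  obtain c where c: "\<And>z. z \<in> S \<Longrightarrow> v z - Re (f z) = c" by blast
  have "(\<lambda>z. f z + of_real c) holomorphic_on S"
    using f by (intro holomorphic_intros) (auto simp: holomorphic_on_def field_differentiable_def)
  moreover have "\<forall>z\<in>S. v z = Re (f z + of_real c)" using c by fastforce
  ultimately show ?thesis by blast
qed

section \<open>Integration by parts against a rectifiable curve\<close>

lemma polygon_length_le_curve_length:
  assumes "rectifiable_on g a b" "t 0 = a" "t n = b" "\<And>k. k < n \<Longrightarrow> t k < t (Suc k)"
  shows "(\<Sum>k<n. dist (g (t k)) (g (t (Suc k)))) \<le> curve_length g a b"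
  using assms unfolding curve_length_def rectifiable_on_def polygon_lengths_def
  by (intro cSup_upper) auto

lemma summation_by_parts_inner:
  fixes g M :: "nat \<Rightarrow> 'a::real_inner"
  shows "(\<Sum>k<n. g k \<bullet> (M (Suc k) - M k)) =
    g n \<bullet> M n - g 0 \<bullet> M 0 - (\<Sum>k<n. M (Suc k) \<bullet> (g (Suc k) - g k))"
  by (induction n) (auto simp: inner_diff_right inner_diff_left inner_commute algebra_simps)

text \<open>For a smooth closed curve \<open>g\<close> the integral equals \<open>- \<integral> M \<bullet> g'\<close>, which is at most \<open>K\<close> times the
  length. For a rectifiable \<open>g\<close>, replace \<open>g\<close> on each interval of a fine equidistant partition by
  its value at the left end; the resulting sum is summed by parts, and the increments of \<open>g\<close> then
  form the length of an inscribed polygon.\<close>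

lemma integral_inner_derivative_le_length:
  fixes g M M' :: "real \<Rightarrow> 'a::euclidean_space"
  assumes ab: "a < b"
    and g: "continuous_on {a..b} g" "g a = g b" "rectifiable_on g a b"
    and M: "\<And>t. t \<in> {a..b} \<Longrightarrow> (M has_vector_derivative M' t) (at t within {a..b})"
    and M': "continuous_on {a..b} M'"
    and closed: "M a = M b"
    and K: "\<And>t. t \<in> {a..b} \<Longrightarrow> norm (M t) \<le> K"
  shows "integral {a..b} (\<lambda>t. g t \<bullet> M' t) \<le> K * curve_length g a b"
proof (rule field_le_epsilon)
  fix \<epsilon> :: real assume \<epsilon>: "\<epsilon> > 0"
  have "bounded (M' ` {a..b})"
    using M' by (intro compact_imp_bounded compact_continuous_image) auto
  then obtain C where C: "C > 0" "\<And>t. t \<in> {a..b} \<Longrightarrow> norm (M' t) \<le> C"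
    by (auto simp: bounded_pos)
  \<comment> \<open>Freezing \<open>g\<close> up to an error \<open>\<eta>\<close> changes the integral by at most \<open>\<eta> C (b - a) = \<epsilon>\<close>.\<close>
  define \<eta> where "\<eta> = \<epsilon> / (C * (b - a))"
  have \<eta>: "\<eta> > 0" using \<epsilon> C ab by (simp add: \<eta>_def)
  have "uniformly_continuous_on {a..b} g"
    using g by (intro compact_uniformly_continuous) auto
  with \<eta> obtain \<delta> where \<delta>: "\<delta> > 0"
    and unif: "\<And>s t. s \<in> {a..b} \<Longrightarrow> t \<in> {a..b} \<Longrightarrow> dist s t < \<delta> \<Longrightarrow> dist (g s) (g t) < \<eta>"
    unfolding uniformly_continuous_on_def by metis
  obtain n :: nat where n: "(b - a) / \<delta> < real n" using reals_Archimedean2 by blast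
  have n0: "n > 0" using n ab \<delta> by (smt (verit) divide_pos_pos of_nat_0 gr0I)
  define h where "h = (b - a) / real n"
  have h: "0 < h" "h < \<delta>" using n n0 ab \<delta> by (auto simp: h_def field_simps)
  define t where "t k = a + real k * h" for k
  have t0: "t 0 = a" and tn: "t n = b" using n0 by (auto simp: t_def h_def)
  have tS: "t (Suc k) = t k + h" for k by (simp add: t_def algebra_simps)
  have t_mono: "t i \<le> t j" if "i \<le> j" for i j
    using that h by (simp add: t_def)
  have sub: "{t k..t (Suc k)} \<subseteq> {a..b}" if "k < n" for k
    using that t_mono[of 0 k] t_mono[of "Suc k" n] t0 tn by auto
  let ?f = "\<lambda>s. g s \<bullet> M' s"
  have cont: "continuous_on {a..b} ?f" using g M' by (intro continuous_intros)
  have split: "integral {a..t m} ?f = (\<Sum>k<m. integral {t k..t (Suc k)} ?f)" if "m \<le> n" for m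
    using that
  proof (induction m)
    case 0 then show ?case by (simp add: t0)
  next
    case (Suc m)
    have "integral {a..t (Suc m)} ?f = integral {a..t m} ?f + integral {t m..t (Suc m)} ?f"
      using t_mono[of 0 m] t_mono[of m "Suc m"] t_mono[of "Suc m" n] Suc.prems t0 tn
      by (intro Henstock_Kurzweil_Integration.integral_combine[symmetric] integrable_continuous_interval
          continuous_on_subset[OF cont]) auto
    with Suc show ?case by simp
  qed
  have piece: "integral {t k..t (Suc k)} ?f \<le> g (t k) \<bullet> (M (t (Suc k)) - M (t k)) + \<eta> * C * h"
    if k: "k < n" for k
  proof (rule has_integral_le)
    show "(?f has_integral integral {t k..t (Suc k)} ?f) {t k..t (Suc k)}"
      by (intro integrable_integral integrable_continuous_interval continuous_on_subset[OF cont] sub k)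
    have "(M' has_integral (M (t (Suc k)) - M (t k))) {t k..t (Suc k)}"
      using sub[OF k] t_mono[of k "Suc k"]
      by (intro fundamental_theorem_of_calculus has_vector_derivative_within_subset[OF M]) auto
    from has_integral_linear[OF this bounded_linear_inner_right]
    have "((\<lambda>s. g (t k) \<bullet> M' s) has_integral (g (t k) \<bullet> (M (t (Suc k)) - M (t k)))) {t k..t (Suc k)}"
      by (simp add: o_def)
    moreover have "((\<lambda>s. \<eta> * C) has_integral (\<eta> * C * h)) {t k..t (Suc k)}"
      using has_integral_const_real[of "\<eta> * C" "t k" "t (Suc k)"] h by (simp add: tS mult_ac)
    ultimately show "((\<lambda>s. g (t k) \<bullet> M' s + \<eta> * C) has_integral
        (g (t k) \<bullet> (M (t (Suc k)) - M (t k)) + \<eta> * C * h)) {t k..t (Suc k)}"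
      by (rule has_integral_add)
  next
    fix s assume s: "s \<in> {t k..t (Suc k)}"
    then have sab: "s \<in> {a..b}" "t k \<in> {a..b}" using sub[OF k] t_mono[of k "Suc k"] by auto
    have "dist s (t k) < \<delta>" using s h tS[of k] by (simp add: dist_real_def)
    then have "norm (g s - g (t k)) \<le> \<eta>"
      using unif[OF sab] by (simp add: dist_norm)
    then have "(g s - g (t k)) \<bullet> M' s \<le> \<eta> * C"
      using norm_cauchy_schwarz[of "g s - g (t k)" "M' s"] C(2)[OF sab(1)] \<eta>
      by (smt (verit) mult_mono norm_ge_zero)
    then show "?f s \<le> g (t k) \<bullet> M' s + \<eta> * C" by (simp add: inner_diff_left)
  qed
  have parts: "(\<Sum>k<n. g (t k) \<bullet> (M (t (Suc k)) - M (t k))) \<le> K * curve_length g a b"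
  proof -
    have "(\<Sum>k<n. g (t k) \<bullet> (M (t (Suc k)) - M (t k)))
        = (\<Sum>k<n. M (t (Suc k)) \<bullet> (g (t k) - g (t (Suc k))))"
      using summation_by_parts_inner[of "\<lambda>k. g (t k)" "\<lambda>k. M (t k)" n] g(2) closed
      by (simp add: t0 tn sum_negf[symmetric] inner_minus_right[symmetric] del: inner_minus_right)
    also have "\<dots> \<le> (\<Sum>k<n. K * dist (g (t k)) (g (t (Suc k))))"
    proof (rule sum_mono)
      fix k assume "k \<in> {..<n}"
      then have "t (Suc k) \<in> {a..b}" using sub[of k] t_mono[of k "Suc k"] by auto
      then have "norm (M (t (Suc k))) * norm (g (t k) - g (t (Suc k))) \<le> K * norm (g (t k) - g (t (Suc k)))"
        using K by (intro mult_right_mono) auto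
      then show "M (t (Suc k)) \<bullet> (g (t k) - g (t (Suc k))) \<le> K * dist (g (t k)) (g (t (Suc k)))"
        unfolding dist_norm by (rule order_trans[OF norm_cauchy_schwarz])
    qed
    also have "\<dots> = K * (\<Sum>k<n. dist (g (t k)) (g (t (Suc k))))" by (rule sum_distrib_left[symmetric])
    also have "\<dots> \<le> K * curve_length g a b"
    proof (rule mult_left_mono)
      show "(\<Sum>k<n. dist (g (t k)) (g (t (Suc k)))) \<le> curve_length g a b"
        using g(3) t0 tn h by (intro polygon_length_le_curve_length) (auto simp: tS)
      show "0 \<le> K" using K[of a] ab norm_ge_zero[of "M a"] by (simp del: norm_ge_zero)
    qed
    finally show ?thesis .
  qed
  have "integral {a..b} ?f = (\<Sum>k<n. integral {t k..t (Suc k)} ?f)"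
    using split[of n] by (simp add: tn)
  also have "\<dots> \<le> (\<Sum>k<n. g (t k) \<bullet> (M (t (Suc k)) - M (t k)) + \<eta> * C * h)"
    using piece by (intro sum_mono) auto
  also have "\<dots> = (\<Sum>k<n. g (t k) \<bullet> (M (t (Suc k)) - M (t k))) + \<eta> * C * (real n * h)"
    by (simp add: sum.distrib)
  also have "\<eta> * C * (real n * h) = \<epsilon>" using n0 C ab by (simp add: \<eta>_def h_def)
  finally show "integral {a..b} ?f \<le> K * curve_length g a b + \<epsilon>" using parts by linarith
qed

section \<open>The first Fourier coefficient of the boundary values\<close>

text \<open>Split \<open>Re f = (f + cnj f) / 2\<close>. Integrated against \<open>cis (- t)\<close>, the first half gives \<open>\<pi> r f'(0)\<close> by Cauchy's formula
  for the derivative, and the second half is the conjugate of \<open>\<integral> f cis t / 2\<close>, which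
  vanishes by Cauchy's theorem.\<close>

lemma Cauchy_Re_first_coefficient:
  assumes f: "f holomorphic_on ball 0 1" and r: "0 < r" "r < 1"
  shows "((\<lambda>t. of_real (Re (f (of_real r * cis t))) * cis (- t)) has_integral
           of_real (pi * r) * deriv f 0) {0..2 * pi}"
proof -
  have sub: "cball 0 r \<subseteq> ball (0::complex) 1" using r by auto
  have cont: "continuous_on (cball 0 r) f"
    using f sub holomorphic_on_imp_continuous_on continuous_on_subset by blast
  have hol: "f holomorphic_on ball 0 r"
    using f sub by (meson ball_subset_cball holomorphic_on_subset)
  have "((\<lambda>w. f w / w\<^sup>2) has_contour_integral 2 * pi * \<i> * deriv f 0) (circlepath 0 r)"
    using Cauchy_has_contour_integral_higher_derivative_circlepath[OF cont hol, of 0 1] r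
    by (simp add: power2_eq_square)
  then have "((\<lambda>t. f (r * cis t) / (r * cis t)\<^sup>2 * r * \<i> * cis t) has_integral
      2 * pi * \<i> * deriv f 0) {0..2 * pi}"
    unfolding circlepath_def by (subst (asm) has_contour_integral_part_circlepath_iff) auto
  from has_integral_mult_left[OF this, of "r / (2 * \<i>)"]
  have "((\<lambda>t. f (r * cis t) / (r * cis t)\<^sup>2 * r * \<i> * cis t * (r / (2 * \<i>))) has_integral
      2 * pi * \<i> * deriv f 0 * (r / (2 * \<i>))) {0..2 * pi}" .
  also have "(\<lambda>t. f (r * cis t) / (r * cis t)\<^sup>2 * r * \<i> * cis t * (r / (2 * \<i>))) =
      (\<lambda>t. f (r * cis t) * cis (- t) / 2)"
  proof
    fix t
    have "cis (- t) * cis t = 1" by (simp add: cis_mult)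
    then show "f (r * cis t) / (r * cis t)\<^sup>2 * r * \<i> * cis t * (r / (2 * \<i>)) = f (r * cis t) * cis (- t) / 2"
      using r by (simp add: power2_eq_square divide_simps)
  qed
  also have "2 * pi * \<i> * deriv f 0 * (r / (2 * \<i>)) = pi * r * deriv f 0"
    by (simp add: complex_eq_iff algebra_simps)
  finally have 1: "((\<lambda>t. f (r * cis t) * cis (- t) / 2) has_integral pi * r * deriv f 0) {0..2 * pi}" .
  have "(f has_contour_integral 0) (circlepath 0 r)"
    using r by (intro Cauchy_theorem_disc_simple[OF f]) auto
  then have "((\<lambda>t. f (r * cis t) * r * \<i> * cis t) has_integral 0) {0..2 * pi}"
    unfolding circlepath_def by (subst (asm) has_contour_integral_part_circlepath_iff) auto
  from has_integral_mult_left[OF this, of "1 / (2 * r * \<i>)"]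
  have "((\<lambda>t. f (r * cis t) * cis t / 2) has_integral 0) {0..2 * pi}"
    using r by (simp add: mult_ac)
  then have 2: "((\<lambda>t. cnj (f (r * cis t)) * cis (- t) / 2) has_integral 0) {0..2 * pi}"
    using has_integral_cnj[of "\<lambda>t. f (r * cis t) * cis t / 2" 0 "{0..2 * pi}"]
    by (simp add: o_def cis_cnj)
  have "f w * c / 2 + cnj (f w) * c / 2 = of_real (Re (f w)) * c" for w c
    by (simp add: complex_eq_iff field_simps)
  with has_integral_add[OF 1 2] show ?thesis by simp
qed


text \<open>The identity on circles of radius \<open>r < 1\<close> extends to \<open>r = 1\<close>, since the integral depends
  continuously on \<open>r\<close> when \<open>v\<close> is continuous on the closed disk.\<close>

lemma first_Fourier_coefficient_of_boundary_values:
  fixes v :: "complex \<Rightarrow> real"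
  assumes v: "continuous_on (cball 0 1) v" and f: "f holomorphic_on ball 0 1"
    and vf: "\<And>z. z \<in> ball 0 1 \<Longrightarrow> v z = Re (f z)"
  shows "((\<lambda>t. of_real (v (cis t)) * cis (- t)) has_integral of_real pi * deriv f 0) {0..2 * pi}"
proof -
  define I where "I r = integral (cbox 0 (2 * pi)) (\<lambda>t. of_real (v (of_real r * cis t)) * cis (- t))" for r
  have v_cont: "continuous_on X (\<lambda>x. complex_of_real (v (g x)))"
    if "continuous_on X g" "g ` X \<subseteq> cball 0 1" for X and g :: "'b::topological_space \<Rightarrow> complex"
    by (rule continuous_on_of_real[OF continuous_on_compose2[OF v that]])
  have cont: "continuous_on ({0..1} \<times> cbox 0 (2 * pi))
      (\<lambda>(r, t). complex_of_real (v (of_real r * cis t)) * cis (- t))"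
    unfolding case_prod_unfold
    by (rule continuous_on_mult[OF v_cont]) (auto intro!: continuous_intros simp: norm_mult)
  have I: "continuous_on {0..1} I"
    unfolding I_def by (rule integral_continuous_on_param[OF cont])
  have "I r = of_real (pi * r) * deriv f 0" if "r \<in> {0<..<1}" for r
  proof -
    have "I r = integral {0..2*pi} (\<lambda>t. of_real (Re (f (of_real r * cis t))) * cis (- t))"
      unfolding I_def using that by (auto intro!: integral_cong simp: vf norm_mult)
    then show ?thesis
      using integral_unique[OF Cauchy_Re_first_coefficient[OF f, of r]] that by simp
  qed
  then have "I r - of_real (pi * r) * deriv f 0 = 0" if "r \<in> {0<..<1}" for r
    using that by simp
  moreover have "continuous_on (closure {0<..<1}) (\<lambda>r. I r - of_real (pi * r) * deriv f 0)"
    using I by (intro continuous_intros) simp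
  ultimately have "I 1 - of_real (pi * 1) * deriv f 0 = 0"
    using continuous_constant_on_closure[of "{0<..<1}" "\<lambda>r. I r - of_real (pi * r) * deriv f 0" 0 1] by simp
  moreover have "(\<lambda>t. of_real (v (cis t)) * cis (- t)) integrable_on {0..2 * pi}"
    by (rule integrable_continuous_interval, rule continuous_on_mult[OF v_cont])
      (auto intro!: continuous_intros)
  ultimately show ?thesis
    by (simp add: I_def has_integral_iff)
qed

section \<open>The differential at the centre and the energy inequality\<close>

lemma bounded_linear_Re_vec_mult: "bounded_linear (\<lambda>h. Re_vec (h *s c))"
  unfolding linear_conv_bounded_linear[symmetric]
  by (rule linearI) (simp_all add: Re_vec_def vec_eq_iff algebra_simps)

lemma has_derivative_Re_vec:
  fixes u :: "complex \<Rightarrow> real ^ 'm"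
  assumes F: "holomorphic_map_on F S" and S: "open S" "z \<in> S"
    and u: "\<And>w. w \<in> S \<Longrightarrow> u w = Re_vec (F w)"
  shows "(u has_derivative (\<lambda>h. Re_vec (h *s deriv_map F z))) (at z)"
proof -
  have "((\<lambda>w. u w $ i) has_derivative (\<lambda>h. Re_vec (h *s deriv_map F z) $ i)) (at z)" for i
  proof (rule has_derivative_transform_within_open[OF _ S])
    have "((\<lambda>w. F w $ i) has_field_derivative deriv (\<lambda>w. F w $ i) z) (at z)"
      using F S by (auto simp: holomorphic_map_on_def intro!: holomorphic_derivI)
    then have "((\<lambda>w. F w $ i) has_derivative (\<lambda>h. deriv (\<lambda>w. F w $ i) z * h)) (at z)"
      by (simp add: has_field_derivative_def)
    from has_derivative_Re[OF this]
    show "((\<lambda>w. Re (F w $ i)) has_derivative (\<lambda>h. Re_vec (h *s deriv_map F z) $ i)) (at z)"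
      by (simp add: Re_vec_def deriv_map_def mult.commute)
  qed (simp add: u Re_vec_def)
  then show ?thesis
    by (subst has_derivative_componentwise_within) (auto simp: Basis_vec_def inner_axis)
qed

lemma norm_squared_eq_partials:
  "(norm c)\<^sup>2 = (norm (Re_vec (1 *s c)))\<^sup>2 + (norm (Re_vec (\<i> *s c)))\<^sup>2"
  by (simp add: norm_vec_def L2_set_def sum_nonneg Re_vec_def cmod_power2 sum.distrib)

lemma onorm_Re_vec_mult_le: "onorm (\<lambda>h. Re_vec (h *s c)) \<le> norm c"
proof (rule onorm_le)
  fix h
  have "norm (Re_vec (h *s c)) \<le> L2_set (\<lambda>i. norm h * norm (c $ i)) UNIV"
    unfolding norm_vec_def
    by (intro L2_set_mono) (auto simp: Re_vec_def norm_mult[symmetric]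
        simp del: norm_mult times_complex.sel intro!: abs_Re_le_cmod)
  also have "\<dots> = norm c * norm h"
    by (simp add: norm_vec_def L2_set_right_distrib mult.commute)
  finally show "norm (Re_vec (h *s c)) \<le> norm c * norm h" .
qed

lemma curve_length_nonneg:
  assumes "rectifiable_on g a b" "a < b"
  shows "0 \<le> curve_length g a b"
proof -
  have "dist (g a) (g b) \<le> curve_length g a b"
    using polygon_length_le_curve_length[OF assms(1), of "\<lambda>k. if k = 0 then a else b" 1] assms(2) by simp
  then show ?thesis using zero_le_dist order_trans by blast
qed

text \<open>The \<open>i\<close>-th component of the Fourier identity is multiplied by the conjugate of \<open>c\<^sub>i\<close> and summed
  over \<open>i\<close>. Testing with \<open>c\<close> itself, rather than estimating the vector-valued integral, keeps the
  operator norm of the differential on the right-hand side, which is what makes the conformal case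
  sharp.\<close>

lemma energy_le_onorm_times_length:
  fixes u :: "complex \<Rightarrow> real ^ 'm"
  assumes u: "continuous_on (cball 0 1) u"
    and F: "holomorphic_map_on F (ball 0 1)"
    and uF: "\<And>z. z \<in> ball 0 1 \<Longrightarrow> u z = Re_vec (F z)"
    and rect: "rectifiable_on (\<lambda>t. u (cis t)) 0 (2 * pi)"
  shows "pi * (norm (deriv_map F 0))\<^sup>2 \<le>
    onorm (\<lambda>h. Re_vec (h *s deriv_map F 0)) * curve_length (\<lambda>t. u (cis t)) 0 (2 * pi)"
proof -
  define c where "c = deriv_map F 0"
  define A where "A h = Re_vec (h *s c)" for h
  have A: "bounded_linear A"
    unfolding A_def by (rule bounded_linear_Re_vec_mult)
  have comp: "((\<lambda>t. u (cis t) $ i * A (cis t) $ i) has_integral pi * (norm (c $ i))\<^sup>2) {0..2 * pi}" for i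
  proof -
    \<comment> \<open>The real part of \<open>cis (- t) * cnj (c $ i)\<close> is that of \<open>cis t * c $ i\<close>, i.e. \<open>A (cis t) $ i\<close>.\<close>
    have "((\<lambda>t. of_real (u (cis t) $ i) * cis (- t)) has_integral of_real pi * c $ i) {0..2 * pi}"
      unfolding c_def deriv_map_def vec_lambda_beta
      using F uF
      by (intro first_Fourier_coefficient_of_boundary_values continuous_intros u)
        (auto simp: holomorphic_map_on_def Re_vec_def)
    from has_integral_linear[OF has_integral_mult_left[OF this, of "cnj (c $ i)"] bounded_linear_Re]
    show ?thesis
      unfolding cmod_power2 by (simp add: o_def A_def Re_vec_def power2_eq_square algebra_simps)
  qed
  have "((\<lambda>t. \<Sum>i\<in>UNIV. u (cis t) $ i * A (cis t) $ i) has_integral (\<Sum>i\<in>UNIV. pi * (norm (c $ i))\<^sup>2)) {0..2 * pi}"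
    by (intro has_integral_sum comp) auto
  then have "((\<lambda>t. u (cis t) \<bullet> A (cis t)) has_integral pi * (norm c)\<^sup>2) {0..2 * pi}"
    by (simp add: inner_vec_def norm_vec_def L2_set_def sum_nonneg sum_distrib_left)
  then have "pi * (norm c)\<^sup>2 = integral {0..2 * pi} (\<lambda>t. u (cis t) \<bullet> A (cis t))"
    by (simp add: integral_unique)
  also have "\<dots> \<le> onorm A * curve_length (\<lambda>t. u (cis t)) 0 (2 * pi)"
  proof (rule integral_inner_derivative_le_length)
    show "continuous_on {0..2 * pi} (\<lambda>t. u (cis t))"
      by (rule continuous_on_compose2[OF u]) (auto intro!: continuous_intros)
    show "continuous_on {0..2 * pi} (\<lambda>t. A (cis t))"
      by (rule bounded_linear.continuous_on[OF A]) (auto intro!: continuous_intros)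
    show "((\<lambda>t. A (- \<i> * cis t)) has_vector_derivative A (cis t)) (at t within {0..2 * pi})" for t
    proof (rule bounded_linear.has_vector_derivative[OF A])
      show "((\<lambda>t. - \<i> * cis t) has_vector_derivative cis t) (at t within {0..2 * pi})"
        unfolding has_vector_derivative_def
        by (auto intro!: derivative_eq_intros simp: fun_eq_iff complex_eq_iff)
    qed
    show "norm (A (- \<i> * cis t)) \<le> onorm A" for t
      using onorm[OF A, of "- \<i> * cis t"] by (simp add: norm_mult)
  qed (use rect in auto)
  finally show ?thesis by (simp add: c_def A_def[abs_def])
qed

lemma onorm_le_of_conformal:
  fixes A :: "complex \<Rightarrow> 'a::real_inner"
  assumes A: "linear A" and eq: "norm (A 1) = norm (A \<i>)" and orth: "A 1 \<bullet> A \<i> = 0"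
  shows "onorm A \<le> norm (A 1)"
proof (rule onorm_le)
  fix h
  interpret linear A by (rule A)
  have "A h = A (Re h *\<^sub>R 1 + Im h *\<^sub>R \<i>)"
    by (rule arg_cong[of _ _ A]) (simp add: complex_eq_iff)
  then have h: "A h = Re h *\<^sub>R A 1 + Im h *\<^sub>R A \<i>" by (simp add: add scale)
  have "(norm (A h))\<^sup>2 = (norm (Re h *\<^sub>R A 1))\<^sup>2 + (norm (Im h *\<^sub>R A \<i>))\<^sup>2"
    unfolding h by (rule norm_add_Pythagorean) (simp add: orthogonal_def orth)
  also have "\<dots> = (norm (A 1) * norm h)\<^sup>2"
    by (simp add: eq[symmetric] cmod_power2 power_mult_distrib algebra_simps)
  finally show "norm (A h) \<le> norm (A 1) * norm h"
    by (simp add: power2_eq_iff_nonneg)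
qed

section \<open>The estimates\<close>

lemma harmonic_map_on_eq_Re_holomorphic:
  fixes u :: "complex \<Rightarrow> real ^ 'm"
  assumes "harmonic_map_on u S" "open S" "convex S"
  shows "\<exists>F. holomorphic_map_on F S \<and> (\<forall>z\<in>S. u z = Re_vec (F z))"
proof -
  have "\<forall>i. \<exists>f. f holomorphic_on S \<and> (\<forall>z\<in>S. u z $ i = Re (f z))"
    using assms by (auto simp: harmonic_map_on_def intro: harmonic_on_eq_Re_holomorphic)
  then obtain f where "\<And>i. f i holomorphic_on S" "\<And>i z. z \<in> S \<Longrightarrow> u z $ i = Re (f i z)"
    by metis
  then show ?thesis
    by (intro exI[of _ "\<lambda>z. \<chi> i. f i z"]) (auto simp: holomorphic_map_on_def Re_vec_def vec_eq_iff)
qed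

theorem theorem17:
  fixes u :: "complex \<Rightarrow> real ^ 'm" and \<gamma> :: "real \<Rightarrow> real ^ 'm" and L :: real
  assumes "continuous_on (cball 0 1) u"
    and "harmonic_map_on u (ball 0 1)"
    and "\<And>t. \<gamma> t = u (exp (\<i> * complex_of_real t))"
    and "rectifiable_on \<gamma> 0 (2 * pi)"
    and "L = curve_length \<gamma> 0 (2 * pi)"
  shows "(\<exists>F :: complex \<Rightarrow> complex ^ 'm.
            holomorphic_map_on F (ball 0 1) \<and> (\<forall>z\<in>ball 0 1. u z = Re_vec (F z)))
       \<and> (\<forall>F :: complex \<Rightarrow> complex ^ 'm.
            holomorphic_map_on F (ball 0 1) \<and> (\<forall>z\<in>ball 0 1. u z = Re_vec (F z)) \<longrightarrow>
            pi * norm (deriv_map F 0) \<le> L)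
       \<and> 2 * pi * norm (wirtinger_z u 0) \<le> L
       \<and> (conformal_at u 0 \<longrightarrow> 2 * pi * differential_norm u 0 \<le> L)"
proof -
  have \<gamma>: "\<gamma> = (\<lambda>t. u (cis t))"
    using assms(3) by (auto simp: cis_conv_exp)
  have rect: "rectifiable_on (\<lambda>t. u (cis t)) 0 (2 * pi)"
    using assms(4) by (simp add: \<gamma>)
  have L: "L = curve_length (\<lambda>t. u (cis t)) 0 (2 * pi)"
    using assms(5) by (simp add: \<gamma>)
  have L0: "0 \<le> L"
    unfolding L by (rule curve_length_nonneg[OF rect]) simp
  \<comment> \<open>\<open>k\<close> will be \<open>|F'(0)|\<close> or the operator norm of the differential, either of which may vanish.\<close>
  have cancel: "pi * (x * k) \<le> L" if "pi * (x * k\<^sup>2) \<le> k * L" "k \<ge> 0" for x k :: real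
  proof (cases "k = 0")
    case False
    then show ?thesis using that by (simp add: power2_eq_square mult_ac)
  qed (use L0 in simp)
  have d1: "pi * norm (deriv_map F 0) \<le> L"
    if F: "holomorphic_map_on F (ball 0 1)" "\<forall>z\<in>ball 0 1. u z = Re_vec (F z)"
    for F :: "complex \<Rightarrow> complex ^ 'm"
  proof -
    have "pi * (norm (deriv_map F 0))\<^sup>2 \<le> onorm (\<lambda>h. Re_vec (h *s deriv_map F 0)) * L"
      unfolding L using F by (intro energy_le_onorm_times_length[OF assms(1) _ _ rect]) auto
    also have "\<dots> \<le> norm (deriv_map F 0) * L"
      by (rule mult_right_mono[OF onorm_Re_vec_mult_le L0])
    finally show ?thesis using cancel[of 1 "norm (deriv_map F 0)"] by simp
  qed
  obtain F :: "complex \<Rightarrow> complex ^ 'm" where F: "holomorphic_map_on F (ball 0 1)"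
    and uF: "\<forall>z\<in>ball 0 1. u z = Re_vec (F z)"
    using harmonic_map_on_eq_Re_holomorphic[OF assms(2)] by auto
  define c where "c = deriv_map F 0"
  define A where "A h = Re_vec (h *s c)" for h
  have du: "(u has_derivative A) (at 0)"
    using has_derivative_Re_vec[OF F, of 0 u] uF by (simp add: A_def[abs_def] c_def)
  have partials: "partial_x u 0 = A 1" "partial_y u 0 = A \<i>"
    by (rule partials_of_derivative[OF du])+
  have "wirtinger_z u 0 = (1/2) *\<^sub>R c"
    unfolding wirtinger_z_def partials by (simp add: A_def Re_vec_def vec_eq_iff complex_eq_iff)
  then have d2: "2 * pi * norm (wirtinger_z u 0) \<le> L"
    using d1[OF F uF] by (simp add: c_def)
  have d3: "2 * pi * differential_norm u 0 \<le> L" if conf: "conformal_at u 0"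
  proof -
    have eq: "norm (A 1) = norm (A \<i>)" and orth: "A 1 \<bullet> A \<i> = 0"
      using conf by (simp_all add: conformal_at_def partials)
    have diff_norm: "differential_norm u 0 = onorm A"
      unfolding differential_norm_def using frechet_derivative_at[OF du] by simp
    have K: "0 \<le> onorm A" "onorm A \<le> norm (A 1)"
      using onorm_pos_le[OF has_derivative_bounded_linear[OF du]]
        onorm_le_of_conformal[OF has_derivative_linear[OF du] eq orth] by auto
    have "pi * (2 * (onorm A)\<^sup>2) \<le> pi * (2 * (norm (A 1))\<^sup>2)"
      using K by (intro mult_left_mono power_mono) auto
    also have "\<dots> = pi * (norm c)\<^sup>2"
      using norm_squared_eq_partials[of c] eq by (simp add: A_def)
    also have "\<dots> \<le> onorm A * L"
      unfolding L A_def[abs_def] c_def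
      using F uF by (intro energy_le_onorm_times_length[OF assms(1) _ _ rect]) auto
    finally show ?thesis using cancel[of 2 "onorm A"] K by (simp add: diff_norm)
  qed
  show ?thesis using F uF d1 d2 d3 by blast
qed

end
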